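(* (a) For every delta operator $\delta=\tau^{-1}\delta_0$ on $\overline{K}_c\{t\}$ there exists a unique basic sequence $\{P_n\}_{n\ge0}$ corresponding to $\delta$, and this sequence is of $K$-binomial type. (b) Conversely, let $\{P_n\}_{n\ge0}$ be a sequence of $K$-binomial type. Define a linear operator $\delta_0$ on $\overline{K}_c\{t\}$ by $\delta_0P_0=0$, $\delta_0P_n=[n]P_{n-1}^q$ for $n\ge1$, extended by linearity (the $P_n$ form a basis of $\overline{K}_c\{t\}$), and set $\delta=\tau^{-1}\delta_0$. Then $\delta$ is a delta operator and $\{P_n\}$ is the basic sequence corresponding to $\delta$.
   Context: Let $p$ be a prime, $q=p^\nu$, $K=\mathbb F_q((x))$ the field of formal Laurent series over $\mathbb F_q$ with absolute value $|\sum_{i\ge m}\zeta_ix^i|=q^{-m}$ ($\zeta_m\neq0$), and $\overline{K}_c$ the completion of an algebraic closure of $K$. $\overline{K}_c\{t\}$ is the $\overline{K}_c$-vector space of $\mathbb F_q$-linear polynomials $u(t)=\sum_k a_kt^{q^k}$ (finite sums, $a_k\in\overline{K}_c$). For $\lambda\in K$, $(\rho_\lambda u)(t)=u(\lambda t)$; a linear operator $T$ on $\overline{K}_c\{t\}$ is invariant if it commutes with every $\rho_\lambda$, $\lambda\in K$. The Frobenius operator is $\tau u=u^q$, i.e. $\tau\sum a_kt^{q^k}=\sum a_k^qt^{q^{k+1}}$; on polynomials without a linear term its inverse is $\tau^{-1}\sum_{k\ge1}a_kt^{q^k}=\sum_{k\ge1}a_k^{1/q}t^{q^{k-1}}$.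 Notation: $[i]=x^{q^i}-x$ ($i\ge1$); $D_0=1$, $D_i=[i][i-1]^q\cdots[1]^{q^{i-1}}$; $\binom{i}{n}_K=\dfrac{D_i}{D_nD_{i-n}^{q^n}}$. A delta operator is an operator $\delta=\tau^{-1}\delta_0$ where $\delta_0$ is a linear invariant operator on $\overline{K}_c\{t\}$ with $\delta_0(t)=0$ and $\delta_0(f)\ne0$ whenever $\deg f>1$ (equivalently $\delta_0(t^{q^n})=c_nt^{q^n}$ with $c_n\neq0$ for all $n\ge1$). A basic sequence corresponding to the delta operator $\delta=\tau^{-1}\delta_0$ is a sequence $\{P_n\}_{n\ge0}$ in $\overline{K}_c\{t\}$ with $\deg P_n=q^n$, $P_0(1)=1$, $P_n(1)=0$ for $n\ge1$, and $\delta P_0=0$, $\delta P_n=[n]^{1/q}P_{n-1}$ for $n\ge1$ (equivalently $\delta_0P_0=0$, $\delta_0P_n=[n]P_{n-1}^q$). A sequence $\{u_i\}_{i\ge0}$ in $\overline{K}_c\{t\}$ is of $K$-binomial type if $\deg u_i=q^i$ and for all $i\ge0$ and all $s,t\in K$: $u_i(st)=\sum_{n=0}^i\binom{i}{n}_K u_n(t)\{u_{i-n}(s)\}^{q^n}$. *)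

theory Defs
  imports "HOL-Analysis.Analysis" "HOL-Algebra.Algebraic_Closure_Type"
    "HOL-Computational_Algebra.Formal_Laurent_Series"
begin

hide_const (open) UnivPoly.coeff UnivPoly.monom Module.smult Polynomials.degree Divisibility.prime

text \<open>
  For a finite field \<open>'a\<close> with \<open>q\<close> elements, \<open>'a fls\<close> is the local field \<open>K\<close> of formal
  Laurent series in \<open>x\<close>, and \<open>'a fls alg_closure\<close> is its algebraic closure.
\<close>

definition K_abs :: "'a::{field,finite} fls \<Rightarrow> real"
  where "K_abs f = (if f = 0 then 0 else real CARD('a) powi (- fls_subdegree f))"

definition of_K :: "('a::field fls alg_closure \<Rightarrow> 'c) \<Rightarrow> 'a fls \<Rightarrow> 'c"
  where "of_K emb f = emb (to_ac f)"

text \<open>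
  A completion of the algebraic closure is described by its defining properties, which
  determine it up to isometric isomorphism over \<open>K\<close>: a field that is complete for an absolute
  value extending the one of \<open>K\<close>, with a dense embedding of the algebraic closure. Completeness is part
  of the class \<open>complete_space\<close>. Since the metric is \<open>absv (z - w)\<close>, the metric
  axioms make \<open>absv\<close> nonnegative, definite and subadditive.
\<close>

locale completed_alg_closure =
  fixes emb :: "'a::{field,finite} fls alg_closure \<Rightarrow> 'c::{field,complete_space}"
    and absv :: "'c \<Rightarrow> real"
  assumes emb_1: "emb 1 = 1"
    and emb_add: "emb (a + b) = emb a + emb b"
    and emb_mult: "emb (a * b) = emb a * emb b"
    and absv_mult: "absv (z * w) = absv z * absv w"
    and dist_absv: "dist z w = absv (z - w)"
    and absv_of_K: "absv (of_K emb f) = K_abs f"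
    and dense_emb: "closure (range emb) = UNIV"

definition bracket :: "nat \<Rightarrow> 'a::{field,finite} fls"
  where "bracket i = fls_X ^ (CARD('a) ^ i) - fls_X"

definition D_K :: "nat \<Rightarrow> 'a::{field,finite} fls"
  where "D_K i = (\<Prod>j<i. bracket (i - j) ^ (CARD('a) ^ j))"

definition K_binom :: "nat \<Rightarrow> nat \<Rightarrow> 'a::{field,finite} fls"
  where "K_binom i n = D_K i / (D_K n * D_K (i - n) ^ (CARD('a) ^ n))"

definition lin_polys :: "nat \<Rightarrow> 'c::field poly set"
  where "lin_polys q = {u. \<forall>i. coeff u i \<noteq> 0 \<longrightarrow> (\<exists>k. i = q ^ k)}"

lemma vector_space_smult_poly: "vector_space (smult :: 'c::field \<Rightarrow> 'c poly \<Rightarrow> 'c poly)"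
  by unfold_locales (auto simp: smult_add_left smult_add_right)

text \<open>
  Operators on \<open>lin_polys q\<close> are functions on all polynomials of which only the restriction
  to \<open>lin_polys q\<close> matters.
\<close>

definition linear_operator :: "nat \<Rightarrow> ('c::field poly \<Rightarrow> 'c poly) \<Rightarrow> bool"
  where "linear_operator q T \<longleftrightarrow>
    (\<forall>u\<in>lin_polys q. T u \<in> lin_polys q) \<and>
    (\<forall>u\<in>lin_polys q. \<forall>v\<in>lin_polys q. T (u + v) = T u + T v) \<and>
    (\<forall>c. \<forall>u\<in>lin_polys q. T (smult c u) = smult c (T u))"

definition rho :: "('a::{field,finite} fls alg_closure \<Rightarrow> 'c::field) \<Rightarrow> 'a fls \<Rightarrow> 'c poly \<Rightarrow> 'c poly"
  where "rho emb l u = pcompose u [:0, of_K emb l:]"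

definition invariant_operator ::
    "('a::{field,finite} fls alg_closure \<Rightarrow> 'c::field) \<Rightarrow> ('c poly \<Rightarrow> 'c poly) \<Rightarrow> bool"
  where "invariant_operator emb T \<longleftrightarrow>
    linear_operator CARD('a) T \<and>
    (\<forall>l. \<forall>u\<in>lin_polys CARD('a). T (rho emb l u) = rho emb l (T u))"

text \<open>
  The \<open>q\<close>-th root is unique because the characteristic divides \<open>q\<close>; it exists since the completed
  algebraic closure is perfect.
\<close>

definition qroot :: "nat \<Rightarrow> 'c::field \<Rightarrow> 'c"
  where "qroot q a = (THE b. b ^ q = a)"

text \<open>
  \<open>tau_inv q\<close> is meaningful only on members of \<open>lin_polys q\<close> without a linear term. Summing up to
  the degree of \<open>u\<close> covers all nonzero coefficients, as \<open>k \<le> q ^ k\<close>.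
\<close>

definition tau_inv :: "nat \<Rightarrow> 'c::field poly \<Rightarrow> 'c poly"
  where "tau_inv q u = (\<Sum>k=1..degree u. monom (qroot q (coeff u (q ^ k))) (q ^ (k - 1)))"

definition delta_core ::
    "('a::{field,finite} fls alg_closure \<Rightarrow> 'c::field) \<Rightarrow> ('c poly \<Rightarrow> 'c poly) \<Rightarrow> bool"
  where "delta_core emb \<delta>0 \<longleftrightarrow>
    invariant_operator emb \<delta>0 \<and> \<delta>0 [:0, 1:] = 0 \<and>
    (\<forall>f\<in>lin_polys CARD('a). degree f > 1 \<longrightarrow> \<delta>0 f \<noteq> 0)"

definition delta_operator ::
    "('a::{field,finite} fls alg_closure \<Rightarrow> 'c::field) \<Rightarrow> ('c poly \<Rightarrow> 'c poly) \<Rightarrow> bool"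
  where "delta_operator emb \<delta> \<longleftrightarrow>
    (\<exists>\<delta>0. delta_core emb \<delta>0 \<and> (\<forall>u\<in>lin_polys CARD('a). \<delta> u = tau_inv CARD('a) (\<delta>0 u)))"

definition basic_sequence ::
    "('a::{field,finite} fls alg_closure \<Rightarrow> 'c::field) \<Rightarrow> ('c poly \<Rightarrow> 'c poly) \<Rightarrow> (nat \<Rightarrow> 'c poly) \<Rightarrow> bool"
  where "basic_sequence emb \<delta> P \<longleftrightarrow>
    (\<forall>n. P n \<in> lin_polys CARD('a) \<and> degree (P n) = CARD('a) ^ n) \<and>
    poly (P 0) 1 = 1 \<and> (\<forall>n\<ge>1. poly (P n) 1 = 0) \<and>
    \<delta> (P 0) = 0 \<and>
    (\<forall>n\<ge>1. \<delta> (P n) = smult (qroot CARD('a) (of_K emb (bracket n))) (P (n - 1)))"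

definition K_binomial_type ::
    "('a::{field,finite} fls alg_closure \<Rightarrow> 'c::field) \<Rightarrow> (nat \<Rightarrow> 'c poly) \<Rightarrow> bool"
  where "K_binomial_type emb u \<longleftrightarrow>
    (\<forall>i. u i \<in> lin_polys CARD('a) \<and> degree (u i) = CARD('a) ^ i) \<and>
    (\<forall>i s t. poly (u i) (of_K emb (s * t)) =
      (\<Sum>n\<le>i. of_K emb (K_binom i n) * poly (u n) (of_K emb t) *
        poly (u (i - n)) (of_K emb s) ^ (CARD('a) ^ n)))"

end

theory Submission
  imports Defs
begin

text \<open>
  An invariant operator is diagonal on the monomials \<open>t^(q^n)\<close>, so for a delta operator the equation
  \<open>\<delta>\<^sub>0 w = [n] v^q\<close> has a solution \<open>w\<close> that is unique up to its linear term, and \<open>w(1) = 0\<close> fixes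
  that term. This gives the basic sequence recursively. For fixed \<open>s\<close>, applying \<open>\<delta>\<^sub>0\<close> to the
  binomial identity of index \<open>i\<close>, read as an identity of polynomials in \<open>t\<close>, gives \<open>[i]\<close> times the
  \<open>q\<close>-th power of the identity of index \<open>i - 1\<close>, because
  \<open>K_binom i n \<cdot> [n] = [i] \<cdot> (K_binom (i-1) (n-1))^q\<close>. Both directions follow by reading this
  computation either way: forwards, the two sides differ by a linear term that vanishes at \<open>1\<close>;
  backwards, it says that \<open>\<delta>\<^sub>0\<close> commutes with the substitutions \<open>t \<mapsto> s t\<close> on the basis \<open>P\<^sub>n\<close>.
\<close>

text \<open>Translation by 1 permutes a finite ring, so the sum of all elements is unchanged when 1
  is added to each; the difference is the cardinality. This links the characteristic to
  \<open>q\<close>.\<close>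

lemma of_nat_CARD_eq_0: "of_nat CARD('a) = (0 :: 'a::{finite, ring_1})"
proof -
  have "(\<Sum>x\<in>(UNIV :: 'a set). x + 1) = (\<Sum>x\<in>UNIV. x)"
    by (rule sum.reindex_bij_witness[of _ "\<lambda>x. x - 1" "\<lambda>x. x + 1"]) auto
  then show ?thesis
    by (simp add: sum.distrib)
qed

lemma smult_sum_right: "smult c (\<Sum>i\<in>A. f i) = (\<Sum>i\<in>A. smult c (f i :: 'c::field poly))"
  by (rule poly_eqI) (simp add: coeff_sum sum_distrib_left)

section \<open>Linear polynomials: closure properties, degrees, coefficients\<close>

lemma lin_polysD: "u \<in> lin_polys q \<Longrightarrow> coeff u i \<noteq> 0 \<Longrightarrow> \<exists>k. i = q ^ k"
  by (auto simp: lin_polys_def)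

lemma lin_polys_eqI:
  assumes "u \<in> lin_polys q" "v \<in> lin_polys q" "\<And>k. coeff u (q ^ k) = coeff v (q ^ k)"
  shows "u = v"
  using assms by (intro poly_eqI) (metis lin_polysD)

lemma lin_polys_0 [intro, simp]: "0 \<in> lin_polys q"
  by (simp add: lin_polys_def)

lemma lin_polys_add [intro]: "u \<in> lin_polys q \<Longrightarrow> v \<in> lin_polys q \<Longrightarrow> u + v \<in> lin_polys q"
  unfolding lin_polys_def by simp (metis add_0)

lemma lin_polys_smult [intro]: "u \<in> lin_polys q \<Longrightarrow> smult c u \<in> lin_polys q"
  by (simp add: lin_polys_def)

lemma lin_polys_diff [intro]: "u \<in> lin_polys q \<Longrightarrow> v \<in> lin_polys q \<Longrightarrow> u - v \<in> lin_polys q"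
  using lin_polys_add[of u q "smult (-1) v"] lin_polys_smult[of v q "-1"] by simp

lemma lin_polys_sum [intro]: "(\<And>i. i \<in> A \<Longrightarrow> f i \<in> lin_polys q) \<Longrightarrow> sum f A \<in> lin_polys q"
  by (induction A rule: infinite_finite_induct) auto

lemma lin_polys_monom [intro]: "monom c (q ^ k) \<in> lin_polys q"
  by (auto simp: lin_polys_def split: if_splits)

lemma lin_polys_linear [intro, simp]: "[:0, c:] \<in> lin_polys q"
  using lin_polys_monom[of c q 0] by (simp add: monom_altdef)

lemma lin_polys_pcompose_scale [intro]: "u \<in> lin_polys q \<Longrightarrow> pcompose u [:0, c:] \<in> lin_polys q"
  by (simp add: lin_polys_def coeff_pcompose_linear)

lemma subspace_lin_polys: "module.subspace smult (lin_polys q)"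
proof -
  interpret vector_space "smult :: 'a \<Rightarrow> 'a poly \<Rightarrow> 'a poly"
    by (rule vector_space_smult_poly)
  show ?thesis
    by (auto simp: subspace_def)
qed

lemma less_power_of_gt1: "1 < q \<Longrightarrow> k < q ^ k" for q :: nat
  using power_gt_expt[of q k] by simp

text \<open>The degree of a nonzero member is itself a power of \<open>q\<close>, so only the
  coefficients at such exponents matter.\<close>

lemma lin_polys_degree_less:
  assumes "1 < q" "u \<in> lin_polys q" "\<And>k. n \<le> k \<Longrightarrow> coeff u (q ^ k) = 0"
  shows "degree u < q ^ n"
proof (cases "u = 0")
  case True
  then show ?thesis using assms(1) by simp
next
  case False
  then have "coeff u (degree u) \<noteq> 0" by simp
  with assms(2) obtain k where k: "degree u = q ^ k" by (blast dest: lin_polysD)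
  with \<open>coeff u (degree u) \<noteq> 0\<close> assms(3)[of k] have "k < n" by (metis not_le)
  then show ?thesis using k assms(1) by simp
qed

lemma lin_polys_degree_0:
  assumes "1 < q" "u \<in> lin_polys q" "degree u < 1"
  shows "u = 0"
proof (rule lin_polys_eqI[OF assms(2)])
  fix k
  have "degree u < q ^ k" using assms by (simp add: order.strict_trans2)
  then show "coeff u (q ^ k) = coeff 0 (q ^ k)" by (simp add: coeff_eq_0)
qed simp

lemma coeff_linear_power: "1 < q \<Longrightarrow> coeff [:0, a:] (q ^ Suc k) = 0"
  using one_less_power[of q "Suc k"]
  by (intro coeff_eq_0 order.strict_trans1[of "degree [:0, a:]" 1]) auto

text \<open>Serves the uniqueness arguments: two solutions of the same equation for a core operator
  agree above the linear term, and their difference then has this shape.\<close>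

lemma lin_polys_eq_linear:
  assumes "1 < q" "u \<in> lin_polys q" "\<And>k. coeff u (q ^ Suc k) = 0"
  shows "u = [:0, coeff u 1:]"
proof (rule lin_polys_eqI[OF assms(2)])
  fix k
  show "coeff u (q ^ k) = coeff [:0, coeff u 1:] (q ^ k)"
  proof (cases k)
    case (Suc m)
    with assms(3)[of m] coeff_linear_power[OF assms(1), of _ m] show ?thesis by metis
  qed simp
qed simp

lemma lin_polys_degree_1E:
  assumes "1 < q" "u \<in> lin_polys q" "degree u = 1"
  obtains a where "u = [:0, a:]"
proof -
  have "coeff u (q ^ Suc k) = 0" for k
    using one_less_power[of q "Suc k"] assms(1,3) by (intro coeff_eq_0) simp
  with lin_polys_eq_linear[OF assms(1,2)] that show thesis by blast
qed

lemma lin_polys_expand: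
  assumes "1 < q" "u \<in> lin_polys q"
  shows "u = (\<Sum>k\<le>degree u. monom (coeff u (q ^ k)) (q ^ k))"
proof (rule lin_polys_eqI[OF assms(2)])
  fix j
  have "coeff (\<Sum>k\<le>degree u. monom (coeff u (q ^ k)) (q ^ k)) (q ^ j) =
      (\<Sum>k\<le>degree u. if k = j then coeff u (q ^ k) else 0)"
    using assms(1) by (auto simp: coeff_sum intro!: sum.cong)
  \<comment> \<open>The range up to \<open>degree u\<close> suffices: if \<open>j\<close> lies
    beyond it, then so does \<open>q ^ j > j\<close>, and the coefficient is zero.\<close>
  also have "\<dots> = coeff u (q ^ j)"
    using less_power_of_gt1[OF assms(1), of j] by (simp add: coeff_eq_0)
  finally show "coeff u (q ^ j) = coeff (\<Sum>k\<le>degree u. monom (coeff u (q ^ k)) (q ^ k)) (q ^ j)" ..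
qed auto

section \<open>Polynomials of degrees \<open>q ^ n\<close> as a basis\<close>

context
  fixes q :: nat and P :: "nat \<Rightarrow> 'c::field poly"
  assumes q: "1 < q"
    and P_lin: "\<And>n. P n \<in> lin_polys q"
    and P_deg: "\<And>n. degree (P n) = q ^ n"
begin

interpretation vector_space "smult :: 'c \<Rightarrow> 'c poly \<Rightarrow> 'c poly"
  by (rule vector_space_smult_poly)

lemma inj_of_degree: "inj P"
  using q P_deg by (metis injI power_inject_exp)

lemma coeff_top_nonzero: "coeff (P n) (q ^ n) \<noteq> 0"
  using P_deg[of n] q by (metis degree_0 leading_coeff_0_iff not_one_less_zero power_eq_0_iff less_nat_zero_code)

text \<open>In a vanishing combination, the member \<open>P m\<close> of largest index with a
  nonzero factor is the only one to contribute at the exponent \<open>q ^ m\<close>.\<close>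

lemma independent_of_degree: "\<not> dependent (range P)"
proof
  assume "dependent (range P)"
  then obtain S c where S: "finite S" "S \<subseteq> range P" "\<exists>v\<in>S. c v \<noteq> 0" and eq: "(\<Sum>v\<in>S. smult (c v) v) = 0"
    unfolding dependent_explicit by blast
  \<comment> \<open>Passing from the polynomials in \<open>S\<close> to their indices makes a
    maximum available; injectivity of \<open>P\<close> keeps \<open>N\<close> finite.\<close>
  define N where "N = {n. P n \<in> S \<and> c (P n) \<noteq> 0}"
  have "finite N"
    using finite_vimageI[OF S(1) inj_of_degree] by (rule rev_finite_subset) (auto simp: N_def)
  moreover have "N \<noteq> {}" using S unfolding N_def by blast
  ultimately have m: "Max N \<in> N" "\<And>n. n \<in> N \<Longrightarrow> n \<le> Max N" by simp_all
  define m where "m = Max N"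
  have other: "coeff (smult (c v) v) (q ^ m) = 0" if v: "v \<in> S - {P m}" for v
  proof (cases "c v = 0")
    case False
    obtain n where n: "v = P n" using v S by blast
    then have "n < m" using m(2)[of n] v False unfolding m_def N_def by force
    then have "degree v < q ^ m" using n P_deg q by simp
    then show ?thesis by (simp add: coeff_eq_0)
  qed simp
  have "0 = coeff (\<Sum>v\<in>S. smult (c v) v) (q ^ m)" by (simp add: eq)
  also have "\<dots> = coeff (smult (c (P m)) (P m)) (q ^ m)"
    unfolding coeff_sum using m(1) S(1) sum.neutral[of "S - {P m}", OF ballI, OF other]
    by (subst sum.remove[of _ "P m"]) (auto simp: m_def N_def)
  finally show False
    using m(1) coeff_top_nonzero by (simp add: m_def N_def)
qed

text \<open>For the harder inclusion, multiples of the \<open>P n\<close> are subtracted from the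
  top down until the degree falls below 1, where only 0 is left.\<close>

lemma span_of_degree: "span (range P) = lin_polys q"
proof
  show "span (range P) \<subseteq> lin_polys q"
    using P_lin by (intro span_minimal subspace_lin_polys) auto
  have "u \<in> span (range P)" if "u \<in> lin_polys q" "degree u < q ^ n" for u n
    using that
  proof (induction n arbitrary: u)
    case 0
    then have "u = 0" using lin_polys_degree_0[OF q] by simp
    then show ?case by (simp add: span_zero)
  next
    case (Suc n)
    \<comment> \<open>Chosen to cancel the coefficient at \<open>q ^ n\<close>; the next possible
      exponent is already below \<open>q ^ n\<close>.\<close>
    define a where "a = coeff u (q ^ n) / coeff (P n) (q ^ n)"
    have "degree (u - smult a (P n)) < q ^ n"
    proof (rule lin_polys_degree_less[OF q])
      show "u - smult a (P n) \<in> lin_polys q" using Suc.prems P_lin by auto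
      show "coeff (u - smult a (P n)) (q ^ k) = 0" if "n \<le> k" for k
      proof (cases "k = n")
        case True
        then show ?thesis using coeff_top_nonzero by (simp add: a_def)
      next
        case False
        with that have "n < k" "Suc n \<le> k" by simp_all
        then have "degree (P n) < q ^ k" "degree u < q ^ k"
          using P_deg q Suc.prems(2) power_increasing[of "Suc n" k q] by simp_all
        then show ?thesis by (simp add: coeff_eq_0)
      qed
    qed
    then have "u - smult a (P n) \<in> span (range P)"
      using Suc.prems P_lin by (intro Suc.IH lin_polys_diff lin_polys_smult)
    moreover have "smult a (P n) \<in> span (range P)"
      by (intro span_scale span_base) simp
    ultimately have "(u - smult a (P n)) + smult a (P n) \<in> span (range P)"
      by (rule span_add)
    then show ?case by simp
  qed
  then show "lin_polys q \<subseteq> span (range P)"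
    using less_power_of_gt1[OF q] by blast
qed

text \<open>An independent family extends to a linear map on all polynomials;
  \<open>inv_into\<close> recovers the index of a basis vector. As \<open>lin_polys q\<close> is the
  span, it is mapped into itself.\<close>

lemma linear_operator_extend:
  assumes "\<And>n. f n \<in> lin_polys q"
  obtains T where "linear_operator q T" "\<And>n. T (P n) = f n"
proof -
  interpret vp: vector_space_pair "smult :: 'c \<Rightarrow> 'c poly \<Rightarrow> 'c poly" "smult :: 'c \<Rightarrow> 'c poly \<Rightarrow> 'c poly" ..
  obtain T where T: "Vector_Spaces.linear smult smult T" "\<And>v. v \<in> range P \<Longrightarrow> T v = f (inv_into UNIV P v)"
    using vp.linear_independent_extend[OF independent_of_degree, of "\<lambda>v. f (inv_into UNIV P v)"] by blast
  interpret Vector_Spaces.linear smult smult T by fact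
  have TP: "T (P n) = f n" for n
    using T(2) inj_of_degree by simp
  have "T u \<in> lin_polys q" if "u \<in> lin_polys q" for u
  proof -
    have "u \<in> span (range P)" using that span_of_degree by simp
    then show ?thesis
      by (rule span_induct) (auto simp: subspace_def TP assms add scale zero)
  qed
  then have "linear_operator q T"
    by (simp add: linear_operator_def add scale)
  with TP that show thesis by blast
qed

end

section \<open>Frobenius on the completed algebraic closure\<close>

text \<open>\<open>q\<close> is a parameter tied to \<open>CARD('a)\<close> by an equation, which
  keeps the lemmas short; the theorem instantiates it with \<open>CARD('a)\<close>.\<close>

locale carlitz = completed_alg_closure emb absv
  for emb :: "'a::{field,finite} fls alg_closure \<Rightarrow> 'c::{field,complete_space}"
    and absv :: "'c \<Rightarrow> real" +
  fixes p \<nu> q :: nat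
  assumes p: "prime p" and q_eq: "q = p ^ \<nu>" and card: "CARD('a) = q"
begin

abbreviation \<iota> :: "'a fls \<Rightarrow> 'c" where "\<iota> \<equiv> of_K emb"

lemma q_gt1: "1 < q"
proof -
  have "card {0, 1 :: 'a} \<le> CARD('a)" by (rule card_mono) auto
  then show ?thesis by (simp add: card)
qed

lemma emb_0: "emb 0 = 0"
  using emb_add[of 0 0] by (simp only: add_0 add_cancel_right_right)

lemma emb_power: "emb (x ^ n) = emb x ^ n"
  by (induction n) (simp_all add: emb_1 emb_mult)

lemma emb_diff: "emb (x - y) = emb x - emb y"
  using emb_add[of "x - y" y] by (simp add: algebra_simps)

lemma \<iota>_0 [simp]: "\<iota> 0 = 0"
  and \<iota>_1 [simp]: "\<iota> 1 = 1"
  and \<iota>_add: "\<iota> (f + g) = \<iota> f + \<iota> g"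
  and \<iota>_mult: "\<iota> (f * g) = \<iota> f * \<iota> g"
  and \<iota>_diff: "\<iota> (f - g) = \<iota> f - \<iota> g"
  and \<iota>_power: "\<iota> (f ^ n) = \<iota> f ^ n"
  by (simp_all add: of_K_def emb_0 emb_1 emb_add emb_mult emb_diff emb_power)

lemma \<iota>_eq_0_iff [simp]: "\<iota> f = 0 \<longleftrightarrow> f = 0"
proof
  assume "\<iota> f = 0"
  show "f = 0"
  proof (rule ccontr)
    assume "f \<noteq> 0"
    then have "1 = \<iota> (f * inverse f)" by simp
    also have "\<dots> = 0" by (simp only: \<iota>_mult \<open>\<iota> f = 0\<close> mult_zero_left)
    finally show False by simp
  qed
qed simp

lemma \<iota>_eq_iff: "\<iota> f = \<iota> g \<longleftrightarrow> f = g"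
  using \<iota>_eq_0_iff[of "f - g"] by (simp del: \<iota>_eq_0_iff add: \<iota>_diff) 

lemma \<iota>_of_nat: "\<iota> (of_nat n) = of_nat n"
  by (induction n) (simp_all add: \<iota>_add)

text \<open>The characteristic of a finite field is positive, hence prime, and it divides the
  cardinality \<open>p ^ \<nu>\<close>.\<close>

lemma CHAR_base: "CHAR('a) = p"
proof -
  have "CHAR('a) dvd p ^ \<nu>"
    using of_nat_CARD_eq_0[where ?'a = 'a] by (simp only: of_nat_eq_0_iff_char_dvd card q_eq)
  moreover have "CHAR('a) > 0"
    by (rule finite_imp_CHAR_pos) simp
  then have "prime CHAR('a)"
    by (rule prime_CHAR_semidom)
  ultimately show ?thesis
    using p by (metis prime_dvd_power primes_dvd_imp_eq)
qed

lemma CHAR_field: "CHAR('c) = p"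
proof -
  have "of_nat p = \<iota> (of_nat p)" by (simp add: \<iota>_of_nat)
  also have "of_nat p = (0 :: 'a fls)" by (simp add: of_nat_eq_0_iff_char_dvd CHAR_base)
  finally have "CHAR('c) dvd p" by (simp add: of_nat_eq_0_iff_char_dvd)
  then show ?thesis
    using p CHAR_not_1'[where ?'a = 'c] by (auto simp: prime_nat_iff)
qed

lemma frobenius_add: "(x + y) ^ q = x ^ q + y ^ q" for x y :: 'c
  using freshmans_dream'[of q \<nu> x y] p by (simp add: q_eq CHAR_field)

lemma frobenius_diff: "(x - y) ^ q = x ^ q - y ^ q" for x y :: 'c
  using frobenius_add[of "x - y" y] by (simp add: algebra_simps)

lemma frobenius_sum_poly: "(\<Sum>i\<in>A. f i) ^ q = (\<Sum>i\<in>A. f i ^ q)" for f :: "'i \<Rightarrow> 'c poly"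
  using freshmans_dream_sum'[of q \<nu> f A] p by (simp add: q_eq CHAR_field)

lemma frobenius_inj: "x ^ q = y ^ q \<Longrightarrow> x = y" for x y :: 'c
  using frobenius_diff[of x y] by simp

lemma absv_power: "absv (z ^ n) = absv z ^ n"
proof (induction n)
  case 0
  \<comment> \<open>The value at 1 is inherited from \<open>K\<close>.\<close>
  have "absv 1 = K_abs (1 :: 'a fls)" using absv_of_K[of 1] by simp
  then show ?case by (simp add: K_abs_def)
qed (simp add: absv_mult)

text \<open>
  A root of a limit of elements of the algebraic closure is the limit of their roots, because
  the Frobenius map raises distances to the power \<open>q\<close>.
\<close>

lemma frobenius_surj: "\<exists>b. b ^ q = (a :: 'c)"
proof -
  have dist_frob: "dist (x ^ q) (y ^ q) = dist x y ^ q" for x y :: 'c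
    by (simp add: dist_absv frobenius_diff[symmetric] absv_power)
  have "a \<in> closure (range emb)" using dense_emb by simp
  then obtain f where f: "\<And>n. f n \<in> range emb" "f \<longlonglongrightarrow> a"
    unfolding closure_sequential by blast
  have "\<exists>y. y ^ q = f n" for n
  proof -
    obtain z where z: "f n = emb z" using f(1) by blast
    obtain y where "y ^ q = z" using nth_root_exists[of q z] q_gt1 by auto
    then show ?thesis using z emb_power by metis
  qed
  then obtain g where g: "\<And>n. g n ^ q = f n" by metis
  have "Cauchy g"
  proof (rule metric_CauchyI)
    fix e :: real assume "0 < e"
    then have "0 < e ^ q" by simp
    from metric_CauchyD[OF LIMSEQ_imp_Cauchy[OF f(2)] this]
    obtain M where M: "\<And>m n. M \<le> m \<Longrightarrow> M \<le> n \<Longrightarrow> dist (f m) (f n) < e ^ q" by blast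
    have "dist (g m) (g n) < e" if "M \<le> m" "M \<le> n" for m n
    proof -
      have "dist (g m) (g n) ^ q < e ^ q" using M[OF that] by (simp add: g[symmetric] dist_frob)
      then show ?thesis using \<open>0 < e\<close> by (simp add: power_less_imp_less_base)
    qed
    then show "\<exists>M. \<forall>m\<ge>M. \<forall>n\<ge>M. dist (g m) (g n) < e" by blast
  qed
  then have "convergent g" by (rule Cauchy_convergent)
  then obtain b where b: "g \<longlonglongrightarrow> b" unfolding convergent_def by (rule exE)
  have "(\<lambda>n. dist (g n) b ^ q) \<longlonglongrightarrow> 0 ^ q"
    using tendsto_dist_iff[THEN iffD1, OF b] by (rule tendsto_power)
  then have "(\<lambda>n. dist (f n) (b ^ q)) \<longlonglongrightarrow> 0"
    using q_gt1 tendsto_dist_iff[THEN iffD1, OF b] by (simp add: g[symmetric] dist_frob)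
  then have "f \<longlonglongrightarrow> b ^ q" by (rule tendsto_dist_iff[THEN iffD2])
  with f(2) have "b ^ q = a" by (rule LIMSEQ_unique[THEN sym])
  then show ?thesis ..
qed

section \<open>Roots, powers of order \<open>q\<close> and the inverse Frobenius operator\<close>

lemma qroot_frobenius [simp]: "qroot q (b ^ q) = (b :: 'c)"
  unfolding qroot_def by (rule the_equality) (auto dest: frobenius_inj)

lemma frobenius_qroot [simp]: "qroot q a ^ q = (a :: 'c)"
  using frobenius_surj[of a] by auto

lemma qroot_eq_iff: "qroot q a = b \<longleftrightarrow> a = (b :: 'c) ^ q"
  by auto

text \<open>Additivity of the Frobenius map lets the power act termwise: indices move up by one and
  no linear term remains. This is the operator \<open>\<tau>\<close> in coordinates.\<close>

lemma coeff_power_q: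
  assumes "v \<in> lin_polys q"
  shows "v ^ q \<in> lin_polys q" "coeff (v ^ q) (q ^ Suc k) = coeff v (q ^ k) ^ q"
    "coeff (v ^ q) 1 = (0 :: 'c)"
proof -
  have "v ^ q = (\<Sum>k\<le>degree v. monom (coeff v (q ^ k)) (q ^ k)) ^ q"
    using lin_polys_expand[OF q_gt1 assms] by simp
  also have "\<dots> = (\<Sum>k\<le>degree v. monom (coeff v (q ^ k) ^ q) (q ^ Suc k))"
    by (simp add: frobenius_sum_poly monom_power mult.commute)
  finally have eq: "v ^ q = (\<Sum>k\<le>degree v. monom (coeff v (q ^ k) ^ q) (q ^ Suc k))" .
  show "v ^ q \<in> lin_polys q"
    unfolding eq by (intro lin_polys_sum lin_polys_monom)
  have "coeff (v ^ q) (q ^ Suc k) = (\<Sum>j\<le>degree v. if j = k then coeff v (q ^ j) ^ q else 0)"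
    unfolding eq coeff_sum using q_gt1 by (auto intro!: sum.cong)
  also have "\<dots> = coeff v (q ^ k) ^ q"
    using less_power_of_gt1[OF q_gt1, of k] q_gt1 by (simp add: coeff_eq_0)
  finally show "coeff (v ^ q) (q ^ Suc k) = coeff v (q ^ k) ^ q" .
  show "coeff (v ^ q) 1 = 0"
    unfolding eq coeff_sum using q_gt1 by (auto intro!: sum.neutral)
qed

lemma qroot_0 [simp]: "qroot q 0 = (0 :: 'c)"
  using q_gt1 by (simp add: qroot_eq_iff)

lemma tau_inv_lin_polys: "tau_inv q u \<in> lin_polys q"
  unfolding tau_inv_def by (intro lin_polys_sum lin_polys_monom)

lemma coeff_tau_inv: "coeff (tau_inv q u) (q ^ k) = qroot q (coeff u (q ^ Suc k) :: 'c)"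
proof -
  have "coeff (tau_inv q u) (q ^ k) =
      (\<Sum>j=1..degree u. if j = Suc k then qroot q (coeff u (q ^ j)) else 0)"
    unfolding tau_inv_def coeff_sum using q_gt1 by (intro sum.cong refl) auto
  \<comment> \<open>An index \<open>Suc k\<close> outside the range belongs to an exponent above the
    degree, and the root of the zero coefficient is 0.\<close>
  also have "\<dots> = qroot q (coeff u (q ^ Suc k))"
    using less_power_of_gt1[OF q_gt1, of "Suc k"] by (auto simp: coeff_eq_0)
  finally show ?thesis .
qed

text \<open>Passes between equations for \<open>\<delta>\<close> and root-free ones for
  \<open>\<delta>0\<close>. The condition on \<open>coeff u 1\<close> matters because
  \<open>tau_inv\<close> discards the linear term.\<close>

lemma tau_inv_eq_iff:
  assumes "u \<in> lin_polys q" "coeff u 1 = 0" "v \<in> lin_polys q"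
  shows "tau_inv q u = smult (qroot q b) v \<longleftrightarrow> u = smult b (v ^ q :: 'c poly)"
proof -
  have "tau_inv q u = smult (qroot q b) v \<longleftrightarrow>
      (\<forall>k. coeff (tau_inv q u) (q ^ k) = coeff (smult (qroot q b) v) (q ^ k))"
    using assms(3) tau_inv_lin_polys lin_polys_eqI by (metis lin_polys_smult)
  also have "\<dots> \<longleftrightarrow> (\<forall>k. coeff u (q ^ Suc k) = b * coeff v (q ^ k) ^ q)"
    by (simp add: coeff_tau_inv qroot_eq_iff power_mult_distrib)
  also have "\<dots> \<longleftrightarrow> (\<forall>k. coeff u (q ^ k) = coeff (smult b (v ^ q)) (q ^ k))"
  proof -
    have "coeff (smult b (v ^ q)) (q ^ Suc k) = b * coeff v (q ^ k) ^ q" for k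
      using coeff_power_q(2)[OF assms(3)] by simp
    moreover have "coeff u (q ^ 0) = coeff (smult b (v ^ q)) (q ^ 0)"
      using assms(2) coeff_power_q(3)[OF assms(3)] by simp
    ultimately show ?thesis by (metis not0_implies_Suc)
  qed
  also have "\<dots> \<longleftrightarrow> u = smult b (v ^ q)"
    using assms(1) coeff_power_q(1)[OF assms(3)] lin_polys_eqI by (metis lin_polys_smult)
  finally show ?thesis .
qed

section \<open>Testing polynomial identities on \<open>K\<close>\<close>

lemma fls_X_power_inj: "fls_X ^ m = (fls_X ^ n :: 'a fls) \<longleftrightarrow> m = n"
  by (metis fls_X_power_nth of_nat_eq_iff zero_neq_one)

lemma infinite_range_\<iota>: "infinite (range \<iota>)"
proof
  assume "finite (range \<iota>)"
  then have "finite (range (\<lambda>n. \<iota> (fls_X ^ n)))"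
    by (rule rev_finite_subset) auto
  moreover have "inj (\<lambda>n::nat. \<iota> (fls_X ^ n))"
    by (auto simp: inj_def \<iota>_eq_iff fls_X_power_inj)
  ultimately show False
    using finite_imageD by blast
qed

text \<open>A nonzero polynomial has finitely many roots, whereas the image of \<open>K\<close> is
  infinite.\<close>

lemma poly_eq_on_K:
  assumes "\<And>t. poly u (\<iota> t) = poly v (\<iota> t)"
  shows "u = v"
proof (rule ccontr)
  assume "u \<noteq> v"
  then have "finite {z. poly (u - v) z = 0}"
    by (intro poly_roots_finite) simp
  moreover have "range \<iota> \<subseteq> {z. poly (u - v) z = 0}"
    using assms by auto
  ultimately show False
    using infinite_range_\<iota> finite_subset by blast
qed

section \<open>Invariant operators\<close>

lemma linear_operatorD:
  assumes "linear_operator q T"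
  shows "u \<in> lin_polys q \<Longrightarrow> T u \<in> lin_polys q"
    and "u \<in> lin_polys q \<Longrightarrow> v \<in> lin_polys q \<Longrightarrow> T (u + v) = T u + T v"
    and "u \<in> lin_polys q \<Longrightarrow> T (smult c u) = smult c (T u)"
  using assms by (auto simp: linear_operator_def)

lemma linear_operator_0: "linear_operator q T \<Longrightarrow> T 0 = 0"
  using linear_operatorD(2)[of T 0 0] by (simp only: lin_polys_0 add_0 add_cancel_right_right)

lemma linear_operator_sum:
  assumes "linear_operator q T" "\<And>i. i \<in> A \<Longrightarrow> f i \<in> lin_polys q"
  shows "T (\<Sum>i\<in>A. f i) = (\<Sum>i\<in>A. T (f i))"
  using assms(2)
proof (induction A rule: infinite_finite_induct)
  case (insert i A)
  then have "T (f i + sum f A) = T (f i) + T (sum f A)"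
    by (intro linear_operatorD(2)[OF assms(1)]) auto
  with insert show ?case by simp
qed (simp_all add: linear_operator_0[OF assms(1)])

text \<open>
  Comparing coefficients under \<open>t \<mapsto> x t\<close> suffices, since the powers of \<open>x\<close> are distinct.
\<close>

lemma invariant_operator_diagonal:
  assumes "invariant_operator emb T"
  obtains c where "\<And>u k. u \<in> lin_polys q \<Longrightarrow> coeff (T u) (q ^ k) = c k * coeff u (q ^ k)"
proof
  define M :: "nat \<Rightarrow> 'c poly" where "M n = monom 1 (q ^ n)" for n
  have lin: "linear_operator q T" using assms by (simp add: invariant_operator_def card)
  have M: "M n \<in> lin_polys q" for n unfolding M_def by (rule lin_polys_monom)
  have off: "coeff (T (M n)) (q ^ k) = 0" if "k \<noteq> n" for n k
  proof -
    have "rho emb fls_X (M n) = smult (\<iota> fls_X ^ q ^ n) (M n)"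
      by (rule poly_eqI) (auto simp: rho_def coeff_pcompose_linear M_def)
    then have "smult (\<iota> fls_X ^ q ^ n) (T (M n)) = rho emb fls_X (T (M n))"
      using assms M linear_operatorD(3)[OF lin] by (metis card invariant_operator_def)
    then have "\<iota> fls_X ^ q ^ n * coeff (T (M n)) (q ^ k) = \<iota> fls_X ^ q ^ k * coeff (T (M n)) (q ^ k)"
      by (metis coeff_pcompose_linear coeff_smult rho_def)
    moreover have "\<iota> fls_X ^ q ^ n \<noteq> \<iota> fls_X ^ q ^ k"
      using that q_gt1 by (simp add: \<iota>_power[symmetric] \<iota>_eq_iff fls_X_power_inj)
    ultimately show ?thesis by simp
  qed
  fix u :: "'c poly" and k assume u: "u \<in> lin_polys q"
  have "u = (\<Sum>j\<le>degree u. smult (coeff u (q ^ j)) (M j))"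
    using lin_polys_expand[OF q_gt1 u] by (simp add: M_def smult_monom)
  then have "T u = T (\<Sum>j\<le>degree u. smult (coeff u (q ^ j)) (M j))"
    by (rule arg_cong)
  also have "\<dots> = (\<Sum>j\<le>degree u. T (smult (coeff u (q ^ j)) (M j)))"
    by (intro linear_operator_sum[OF lin] lin_polys_smult M)
  also have "\<dots> = (\<Sum>j\<le>degree u. smult (coeff u (q ^ j)) (T (M j)))"
    using linear_operatorD(3)[OF lin M] by simp
  finally have "coeff (T u) (q ^ k) = (\<Sum>j\<le>degree u. coeff u (q ^ j) * coeff (T (M j)) (q ^ k))"
    by (simp add: coeff_sum)
  also have "\<dots> = (\<Sum>j\<le>degree u. if j = k then coeff (T (M k)) (q ^ k) * coeff u (q ^ j) else 0)"
    by (intro sum.cong refl) (auto simp: off)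
  also have "\<dots> = coeff (T (M k)) (q ^ k) * coeff u (q ^ k)"
    using less_power_of_gt1[OF q_gt1, of k] by (simp add: coeff_eq_0)
  \<comment> \<open>The eigenvalue at \<open>k\<close> is thus read off from the image of the
    monomial \<open>M k\<close>.\<close>
  finally show "coeff (T u) (q ^ k) = coeff (T (M k)) (q ^ k) * coeff u (q ^ k)" .
qed

text \<open>Both conditions on a core operator are tested on monomials: \<open>t\<close> is killed,
  while a zero eigenvalue at a later index would kill a monomial of degree above 1.\<close>

lemma delta_core_diagonal:
  assumes "delta_core emb T"
  obtains c where "\<And>u k. u \<in> lin_polys q \<Longrightarrow> coeff (T u) (q ^ k) = c k * coeff u (q ^ k)"
    and "c 0 = 0" "\<And>k. c (Suc k) \<noteq> 0"
proof -
  have inv: "invariant_operator emb T" and lin: "linear_operator q T" and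
    T0: "T [:0, 1:] = 0" and T: "\<And>f. f \<in> lin_polys q \<Longrightarrow> degree f > 1 \<Longrightarrow> T f \<noteq> 0"
    using assms by (simp_all add: delta_core_def invariant_operator_def card)
  obtain c where c: "\<And>u k. u \<in> lin_polys q \<Longrightarrow> coeff (T u) (q ^ k) = c k * coeff u (q ^ k)"
    using invariant_operator_diagonal[OF inv] by blast
  have "c 0 = 0"
    using c[of "[:0, 1:]" 0] T0 by simp
  moreover have "c (Suc k) \<noteq> 0" for k
  proof
    assume "c (Suc k) = 0"
    define u :: "'c poly" where "u = monom 1 (q ^ Suc k)"
    have u: "u \<in> lin_polys q" unfolding u_def by (rule lin_polys_monom)
    have "T u = 0"
    proof (rule lin_polys_eqI[OF linear_operatorD(1)[OF lin u] lin_polys_0])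
      fix j show "coeff (T u) (q ^ j) = coeff 0 (q ^ j)"
      proof (cases "j = Suc k")
        case False
        then have "coeff u (q ^ j) = 0"
          using q_gt1 by (simp add: u_def del: power_Suc)
        then show ?thesis by (simp add: c[OF u])
      qed (simp add: c[OF u] \<open>c (Suc k) = 0\<close> del: power_Suc)
    qed
    moreover have "degree u > 1"
      using one_less_power[OF q_gt1, of "Suc k"] by (simp add: u_def degree_monom_eq del: power_Suc)
    ultimately show False using T[OF u] by simp
  qed
  ultimately show thesis using that c by blast
qed

section \<open>Basic sequences\<close>

text \<open>Root-free counterpart of \<open>basic_sequence\<close>, stated for the core operator and
  with successor indices to suit recursion.\<close>

definition basic_core :: "('c poly \<Rightarrow> 'c poly) \<Rightarrow> (nat \<Rightarrow> 'c poly) \<Rightarrow> bool" where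
  "basic_core T P \<longleftrightarrow> (\<forall>n. P n \<in> lin_polys q \<and> degree (P n) = q ^ n) \<and>
    poly (P 0) 1 = 1 \<and> (\<forall>n. poly (P (Suc n)) 1 = 0) \<and> T (P 0) = 0 \<and>
    (\<forall>n. T (P (Suc n)) = smult (\<iota> (bracket (Suc n))) (P n ^ q))"

lemma all_ge_1_iff: "(\<forall>n\<ge>1. Q n) \<longleftrightarrow> (\<forall>n::nat. Q (Suc n))"
  by (metis One_nat_def Suc_le_mono le0 not0_implies_Suc not_one_le_zero)

lemma basic_sequence_iff:
  assumes "linear_operator q T" "\<And>u. u \<in> lin_polys q \<Longrightarrow> coeff (T u) 1 = 0"
    and "\<And>u. u \<in> lin_polys q \<Longrightarrow> \<delta> u = tau_inv q (T u)"
  shows "basic_sequence emb \<delta> P \<longleftrightarrow> basic_core T P"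
proof -
  have "\<delta> u = smult (qroot q b) v \<longleftrightarrow> T u = smult b (v ^ q)"
    if "u \<in> lin_polys q" "v \<in> lin_polys q" for u v b
    using tau_inv_eq_iff[of "T u" v b] linear_operatorD(1)[OF assms(1)] that assms(2,3) by simp
  \<comment> \<open>The case \<open>v = 0\<close> yields the condition at index 0, where the right
    side is zero.\<close>
  moreover from this[of _ 0 0] have "\<delta> u = 0 \<longleftrightarrow> T u = 0" if "u \<in> lin_polys q" for u
    using that by simp
  ultimately show ?thesis
    unfolding basic_sequence_def basic_core_def all_ge_1_iff card by auto
qed

lemma bracket_nonzero: "bracket (Suc n) \<noteq> (0 :: 'a fls)"
proof
  assume "bracket (Suc n) = (0 :: 'a fls)"
  then have "fls_X ^ (q ^ Suc n) = (fls_X ^ 1 :: 'a fls)"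
    by (simp add: bracket_def card del: power_Suc)
  then have "q ^ Suc n = 1"
    by (simp only: fls_X_power_inj)
  then show False
    using one_less_power[OF q_gt1, of "Suc n"] by (simp del: power_Suc)
qed

section \<open>Solving one step of the recursion\<close>

lemma basic_step:
  fixes v :: "'c poly"
  assumes "linear_operator q T"
    and c: "\<And>u k. u \<in> lin_polys q \<Longrightarrow> coeff (T u) (q ^ k) = c k * coeff u (q ^ k)"
    and "c 0 = 0" "\<And>k. c (Suc k) \<noteq> 0" and v: "v \<in> lin_polys q"
  shows "\<exists>!w. w \<in> lin_polys q \<and> T w = smult b (v ^ q) \<and> poly w 1 = 0"
proof (rule ex_ex1I)
  \<comment> \<open>Coefficientwise division by the eigenvalues; index \<open>k\<close> of
    \<open>v\<close> feeds index \<open>Suc k\<close>, as the power \<open>v ^ q\<close> shifts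
    indices.\<close>
  define w0 where "w0 = (\<Sum>k\<le>degree v. monom (b * coeff v (q ^ k) ^ q / c (Suc k)) (q ^ Suc k))"
  \<comment> \<open>Since \<open>c 0 = 0\<close>, the linear term is free and can be used to force
    the value 0 at 1.\<close>
  define w where "w = w0 - [:0, poly w0 1:]"
  have w0: "w0 \<in> lin_polys q"
    unfolding w0_def by (intro lin_polys_sum lin_polys_monom)
  then have w: "w \<in> lin_polys q"
    unfolding w_def by auto
  have "coeff w0 (q ^ Suc k) = b * coeff v (q ^ k) ^ q / c (Suc k)" for k
  proof -
    have "coeff w0 (q ^ Suc k) =
        (\<Sum>j\<le>degree v. if j = k then b * coeff v (q ^ j) ^ q / c (Suc j) else 0)"
      unfolding w0_def coeff_sum using q_gt1 by (auto intro!: sum.cong)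
    also have "\<dots> = b * coeff v (q ^ k) ^ q / c (Suc k)"
      using less_power_of_gt1[OF q_gt1, of k] q_gt1 by (simp add: coeff_eq_0)
    finally show ?thesis .
  qed
  then have cw: "coeff w (q ^ Suc k) = b * coeff v (q ^ k) ^ q / c (Suc k)" for k
    by (simp add: w_def coeff_linear_power[OF q_gt1] del: power_Suc)
  have "T w = smult b (v ^ q)"
  proof (rule lin_polys_eqI)
    fix k show "coeff (T w) (q ^ k) = coeff (smult b (v ^ q)) (q ^ k)"
    proof (cases k)
      case 0
      then show ?thesis using c[OF w, of k] \<open>c 0 = 0\<close> coeff_power_q(3)[OF v] by simp
    next
      case (Suc j)
      then show ?thesis using c[OF w, of k] assms(4) cw[of j] coeff_power_q(2)[OF v, of j]
        by (simp del: power_Suc)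
    qed
  qed (use w v assms(1) coeff_power_q(1) linear_operatorD(1) in auto)
  then show "\<exists>w. w \<in> lin_polys q \<and> T w = smult b (v ^ q) \<and> poly w 1 = 0"
    using w by (intro exI[of _ w]) (simp add: w_def)
next
  fix w w'
  assume *: "w \<in> lin_polys q \<and> T w = smult b (v ^ q) \<and> poly w 1 = 0"
    "w' \<in> lin_polys q \<and> T w' = smult b (v ^ q) \<and> poly w' 1 = 0"
  have "coeff (w - w') (q ^ Suc k) = 0" for k
    using * c[of w "Suc k"] c[of w' "Suc k"] assms(4)[of k] by (simp del: power_Suc)
  then have eq: "w - w' = [:0, coeff (w - w') 1:]"
    using * by (intro lin_polys_eq_linear[OF q_gt1]) auto
  \<comment> \<open>The value of a multiple of \<open>t\<close> at 1 is its coefficient, so the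
    normalization removes the remaining freedom.\<close>
  have "coeff (w - w') 1 = poly (w - w') 1"
    by (subst (2) eq) simp
  also have "\<dots> = 0" using * by simp
  finally show "w = w'" using eq by simp
qed

text \<open>Above the linear term the support of \<open>w\<close> is that of \<open>v\<close>
  shifted by one index, because neither \<open>b\<close> nor any \<open>c (Suc k)\<close>
  vanishes.\<close>

lemma basic_step_degree:
  fixes v w :: "'c poly"
  assumes c: "\<And>k. coeff (T w) (q ^ k) = c k * coeff w (q ^ k)"
    and "\<And>k. c (Suc k) \<noteq> 0" and "v \<in> lin_polys q" "w \<in> lin_polys q"
    and T: "T w = smult b (v ^ q)" and "b \<noteq> 0" and "degree v = q ^ n"
  shows "degree w = q ^ Suc n"
proof -
  have *: "c (Suc k) * coeff w (q ^ Suc k) = b * coeff v (q ^ k) ^ q" for k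
    using c[of "Suc k"] coeff_power_q(2)[OF assms(3), of k] by (simp add: T)
  have "v \<noteq> 0" using assms(7) q_gt1 by auto
  then have "coeff v (q ^ n) \<noteq> 0" using assms(7) by (metis leading_coeff_0_iff)
  then have "coeff w (q ^ Suc n) \<noteq> 0" using *[of n] \<open>b \<noteq> 0\<close> by (metis mult_eq_0_iff power_eq_0_iff)
  then have "q ^ Suc n \<le> degree w" by (rule le_degree)
  moreover have "degree w < q ^ Suc (Suc n)"
  proof (rule lin_polys_degree_less[OF q_gt1 assms(4)])
    fix k assume "Suc (Suc n) \<le> k"
    then obtain j where j: "k = Suc j" "n < j" by (metis Suc_le_D Suc_le_eq Suc_less_eq)
    then have "degree v < q ^ j" using assms(7) q_gt1 by simp
    then have "coeff v (q ^ j) = 0" by (rule coeff_eq_0)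
    then show "coeff w (q ^ k) = 0" using *[of j] assms(2)[of j] q_gt1 j by (simp add: power_0_left del: power_Suc)
  qed
  moreover obtain m where m: "degree w = q ^ m"
    using \<open>coeff w (q ^ Suc n) \<noteq> 0\<close> lin_polysD[OF assms(4)] by (metis coeff_0 leading_coeff_0_iff)
  ultimately have "Suc n \<le> m" "m < Suc (Suc n)"
    using q_gt1 by (metis power_le_imp_le_exp, metis power_less_imp_less_exp)
  with m show ?thesis by (simp add: le_less_Suc_eq)
qed

section \<open>Existence and uniqueness of the basic sequence\<close>

lemma basic_core_0: "basic_core T P \<Longrightarrow> P 0 = [:0, 1:]"
proof -
  assume "basic_core T P"
  then have P: "P 0 \<in> lin_polys q" "degree (P 0) = 1" "poly (P 0) 1 = 1"
    by (auto simp: basic_core_def)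
  obtain a where "P 0 = [:0, a:]"
    using lin_polys_degree_1E[OF q_gt1 P(1,2)] .
  with P(3) show ?thesis by simp
qed

lemma ex1_basic_core:
  assumes "delta_core emb T"
  shows "\<exists>!P. basic_core T P"
proof -
  have lin: "linear_operator q T" and T0: "T [:0, 1:] = 0"
    using assms by (simp_all add: delta_core_def invariant_operator_def card)
  obtain c where c: "\<And>u k. u \<in> lin_polys q \<Longrightarrow> coeff (T u) (q ^ k) = c k * coeff u (q ^ k)"
    and c0: "c 0 = 0" and c1: "\<And>k. c (Suc k) \<noteq> 0"
    using delta_core_diagonal[OF assms] by blast
  note step = basic_step[OF lin c c0 c1]
  \<comment> \<open>The condition on \<open>v\<close> sits inside the existential, so that choice
    gives a total function \<open>F\<close> to iterate.\<close>
  have "\<forall>n v. \<exists>w. v \<in> lin_polys q \<longrightarrow>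
      w \<in> lin_polys q \<and> T w = smult (\<iota> (bracket (Suc n))) (v ^ q) \<and> poly w 1 = 0"
    using step by blast
  then obtain F where F: "\<And>n v. v \<in> lin_polys q \<Longrightarrow>
      F n v \<in> lin_polys q \<and> T (F n v) = smult (\<iota> (bracket (Suc n))) (v ^ q) \<and> poly (F n v) 1 = 0"
    by metis
  define P where "P = rec_nat [:0, 1:] F"
  have P_0: "P 0 = [:0, 1:]" and P_Suc: "P (Suc n) = F n (P n)" for n
    by (simp_all add: P_def)
  have P: "P n \<in> lin_polys q \<and> degree (P n) = q ^ n" for n
  proof (induction n)
    case (Suc n)
    have "degree (P (Suc n)) = q ^ Suc n"
    proof (rule basic_step_degree)
      show "T (P (Suc n)) = smult (\<iota> (bracket (Suc n))) (P n ^ q)" "P (Suc n) \<in> lin_polys q"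
        using Suc F by (simp_all add: P_Suc)
      then show "coeff (T (P (Suc n))) (q ^ k) = c k * coeff (P (Suc n)) (q ^ k)" for k
        by (intro c)
    qed (use Suc c1 bracket_nonzero in auto)
    then show ?case using Suc F by (simp add: P_Suc)
  qed (simp add: P_0)
  then have ex: "basic_core T P"
    using F T0 by (simp add: basic_core_def P_Suc P_0)
  have unique: "P = R" if "basic_core T P" "basic_core T R" for P R
  proof
    fix n show "P n = R n"
    proof (induction n)
      case 0
      then show ?case using basic_core_0 that by metis
    next
      case (Suc n)
      show ?case
        using step[of "P n" "\<iota> (bracket (Suc n))"] that Suc unfolding basic_core_def by metis
    qed
  qed
  show ?thesis
  proof (rule ex_ex1I)
    show "\<exists>P. basic_core T P" by (rule exI[of _ P]) (rule ex)
  qed (rule unique)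
qed

section \<open>Sequences of binomial type\<close>

lemma D_K_0: "D_K 0 = (1 :: 'a fls)"
  by (simp add: D_K_def)

text \<open>The factor at \<open>j = 0\<close> is split off; the others are the \<open>q\<close>-th
  powers of the factors of \<open>D_K i\<close>.\<close>

lemma D_K_Suc: "D_K (Suc i) = bracket (Suc i) * (D_K i :: 'a fls) ^ q"
  unfolding D_K_def card
  by (subst prod.lessThan_Suc_shift) (simp add: prod_power_distrib power_mult[symmetric] mult.commute)

lemma D_K_nonzero: "D_K i \<noteq> (0 :: 'a fls)"
  using bracket_nonzero by (induction i) (simp_all add: D_K_0 D_K_Suc)

lemma K_binom_0: "K_binom i 0 = (1 :: 'a fls)"
  and K_binom_self: "K_binom i i = (1 :: 'a fls)"
  by (simp_all add: K_binom_def D_K_0 D_K_nonzero)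

text \<open>Expand \<open>D_K (Suc i)\<close> and \<open>D_K (Suc n)\<close> by
  \<open>D_K_Suc\<close>; as \<open>Suc i - Suc n = i - n\<close>, what remains besides the brackets
  is a \<open>q\<close>-th power.\<close>

lemma K_binom_Suc_Suc:
  "K_binom (Suc i) (Suc n) * bracket (Suc n) = bracket (Suc i) * (K_binom i n :: 'a fls) ^ q"
proof -
  have "(D_K (i - n) ^ q ^ n) ^ q = (D_K (i - n) ^ q ^ Suc n :: 'a fls)"
    by (simp add: power_mult[symmetric] mult.commute)
  then show ?thesis
    using bracket_nonzero[of n] D_K_nonzero[of n]
    by (simp add: K_binom_def D_K_Suc card power_divide power_mult_distrib del: power_Suc)
qed

text \<open>By \<open>poly_eq_on_K\<close>, the condition for all \<open>t\<close> in
  \<open>K\<close> becomes an identity of polynomials, to which operators can be applied;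
  \<open>s\<close> stays a scalar parameter.\<close>

lemma K_binomial_type_iff:
  "K_binomial_type emb u \<longleftrightarrow> (\<forall>i. u i \<in> lin_polys q \<and> degree (u i) = q ^ i) \<and>
    (\<forall>i s. pcompose (u i) [:0, \<iota> s:] =
      (\<Sum>n\<le>i. smult (\<iota> (K_binom i n) * poly (u (i - n)) (\<iota> s) ^ (q ^ n)) (u n)))"
proof -
  have "(\<forall>t. poly (u i) (\<iota> (s * t)) = (\<Sum>n\<le>i. \<iota> (K_binom i n) * poly (u n) (\<iota> t) *
        poly (u (i - n)) (\<iota> s) ^ (q ^ n))) \<longleftrightarrow>
      pcompose (u i) [:0, \<iota> s:] =
        (\<Sum>n\<le>i. smult (\<iota> (K_binom i n) * poly (u (i - n)) (\<iota> s) ^ (q ^ n)) (u n))"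
    (is "(\<forall>t. ?l t = ?r t) \<longleftrightarrow> ?L = ?R") for i s
  proof -
    have "?l t = poly ?L (\<iota> t)" "?r t = poly ?R (\<iota> t)" for t
      by (simp_all add: poly_pcompose \<iota>_mult poly_sum mult_ac)
    then show ?thesis using poly_eq_on_K[of ?L ?R] by auto
  qed
  then show ?thesis
    unfolding K_binomial_type_def card by blast
qed

section \<open>Operators applied to the binomial expansion\<close>

lemma pcompose_scale_power: "pcompose (u ^ n) [:0, a:] = pcompose u [:0, a:] ^ n" for a :: 'c
  by (induction n) (simp_all add: pcompose_mult pcompose_1)

text \<open>
  Applying \<open>T\<close> to the claimed expansion of \<open>P (Suc i)\<close> yields the \<open>q\<close>-th power of the one
  of \<open>P i\<close>.
\<close>

lemma T_expansion:
  assumes lin: "linear_operator q T" and P: "\<And>n. P n \<in> lin_polys q"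
    and T0: "T (P 0) = 0" and T: "\<And>n. T (P (Suc n)) = smult (\<iota> (bracket (Suc n))) (P n ^ q)"
  shows "T (\<Sum>n\<le>Suc i. smult (\<iota> (K_binom (Suc i) n) * a (Suc i - n) ^ (q ^ n)) (P n)) =
    smult (\<iota> (bracket (Suc i))) ((\<Sum>n\<le>i. smult (\<iota> (K_binom i n) * a (i - n) ^ (q ^ n)) (P n)) ^ q)"
proof -
  have "T (\<Sum>n\<le>Suc i. smult (\<iota> (K_binom (Suc i) n) * a (Suc i - n) ^ (q ^ n)) (P n)) =
      (\<Sum>n\<le>Suc i. smult (\<iota> (K_binom (Suc i) n) * a (Suc i - n) ^ (q ^ n)) (T (P n)))"
    using P by (subst linear_operator_sum[OF lin]) (auto simp: linear_operatorD(3)[OF lin])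
  \<comment> \<open>The term at index 0 is killed by \<open>T0\<close>, and the rest is
    reindexed.\<close>
  also have "\<dots> = (\<Sum>n\<le>i. smult (\<iota> (K_binom (Suc i) (Suc n)) * a (i - n) ^ (q ^ Suc n) *
      \<iota> (bracket (Suc n))) (P n ^ q))"
    by (subst sum.atMost_Suc_shift) (simp add: T0 T)
  also have "\<dots> = (\<Sum>n\<le>i. smult (\<iota> (bracket (Suc i)))
      (smult (\<iota> (K_binom i n) * a (i - n) ^ (q ^ n)) (P n) ^ q))"
  proof (rule sum.cong)
    fix n
    have "\<iota> (K_binom (Suc i) (Suc n)) * a (i - n) ^ (q ^ Suc n) * \<iota> (bracket (Suc n)) =
        \<iota> (K_binom (Suc i) (Suc n) * bracket (Suc n)) * a (i - n) ^ (q ^ Suc n)"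
      by (simp add: \<iota>_mult)
    also have "\<dots> = \<iota> (bracket (Suc i)) * (\<iota> (K_binom i n) * a (i - n) ^ (q ^ n)) ^ q"
      unfolding K_binom_Suc_Suc
      by (simp add: \<iota>_mult \<iota>_power power_mult_distrib power_mult[symmetric] mult.commute)
    finally show "smult (\<iota> (K_binom (Suc i) (Suc n)) * a (i - n) ^ (q ^ Suc n) *
        \<iota> (bracket (Suc n))) (P n ^ q) =
        smult (\<iota> (bracket (Suc i))) (smult (\<iota> (K_binom i n) * a (i - n) ^ (q ^ n)) (P n) ^ q)"
      by (simp only: smult_power smult_smult)
  qed simp
  also have "\<dots> = smult (\<iota> (bracket (Suc i)))
      ((\<Sum>n\<le>i. smult (\<iota> (K_binom i n) * a (i - n) ^ (q ^ n)) (P n)) ^ q)"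
    by (simp only: frobenius_sum_poly smult_sum_right)
  finally show ?thesis .
qed

lemma basic_core_imp_binomial:
  assumes core: "delta_core emb T" and basic: "basic_core T P"
  shows "K_binomial_type emb P"
proof -
  have lin: "linear_operator q T"
    and inv: "\<And>l u. u \<in> lin_polys q \<Longrightarrow> T (pcompose u [:0, \<iota> l:]) = pcompose (T u) [:0, \<iota> l:]"
    using core by (simp_all add: delta_core_def invariant_operator_def card rho_def)
  obtain c where c: "\<And>u k. u \<in> lin_polys q \<Longrightarrow> coeff (T u) (q ^ k) = c k * coeff u (q ^ k)"
    and c0: "c 0 = 0" and c1: "\<And>k. c (Suc k) \<noteq> 0"
    using delta_core_diagonal[OF core] by blast
  have P: "P n \<in> lin_polys q" "degree (P n) = q ^ n" and P1: "poly (P 0) 1 = 1" "poly (P (Suc n)) 1 = 0"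
    and TP: "T (P 0) = 0" "T (P (Suc n)) = smult (\<iota> (bracket (Suc n))) (P n ^ q)" for n
    using basic by (simp_all add: basic_core_def)
  have "pcompose (P i) [:0, \<iota> s:] =
      (\<Sum>n\<le>i. smult (\<iota> (K_binom i n) * poly (P (i - n)) (\<iota> s) ^ (q ^ n)) (P n))" for i s
  proof (induction i)
    case 0
    show ?case using basic_core_0[OF basic] by (simp add: K_binom_0 pcompose_pCons)
  next
    case (Suc i)
    define L where "L = pcompose (P (Suc i)) [:0, \<iota> s:]"
    define R where "R = (\<Sum>n\<le>Suc i. smult (\<iota> (K_binom (Suc i) n) * poly (P (Suc i - n)) (\<iota> s) ^ (q ^ n)) (P n))"
    have LR: "L \<in> lin_polys q" "R \<in> lin_polys q"
      unfolding L_def R_def using P(1) by (auto simp del: sum.atMost_Suc)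
    have "T L = smult (\<iota> (bracket (Suc i))) (pcompose (P i) [:0, \<iota> s:] ^ q)"
      by (simp add: L_def inv P TP pcompose_smult pcompose_scale_power)
    also have "\<dots> = T R"
      unfolding R_def Suc.IH
      by (rule T_expansion[OF lin P(1) TP, of i "\<lambda>n. poly (P n) (\<iota> s)", symmetric])
    finally have "T L = T R" .
    \<comment> \<open>Equality of the images determines every coefficient with nonzero eigenvalue,
      that is, all but the linear one.\<close>
    then have "coeff (L - R) (q ^ Suc k) = 0" for k
      using c[OF LR(1), of "Suc k"] c[OF LR(2), of "Suc k"] c1[of k] by (simp del: power_Suc)
    then have eq: "L - R = [:0, coeff (L - R) 1:]"
      using LR by (intro lin_polys_eq_linear[OF q_gt1]) auto
    \<comment> \<open>At 1 only the summand \<open>n = 0\<close> survives, and it equals the value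
      of \<open>L\<close> there.\<close>
    have "poly R 1 = poly (P (Suc i)) (\<iota> s)"
      unfolding R_def poly_sum by (subst sum.atMost_Suc_shift) (simp add: P1 K_binom_0)
    then have "poly (L - R) 1 = 0"
      by (simp add: L_def poly_pcompose)
    moreover have "coeff (L - R) 1 = poly (L - R) 1"
      by (subst (2) eq) simp
    ultimately have "L - R = 0" using eq by simp
    then show ?case by (simp add: L_def R_def)
  qed
  then show ?thesis
    unfolding K_binomial_type_iff using P by blast
qed

text \<open>Put \<open>s = t = 1\<close>. At index 0 the value is a nonzero idempotent. At a later
  index the inner summands vanish by induction and each of the two outer ones equals the value
  \<open>y\<close> sought, so \<open>y = y + y\<close>.\<close>

lemma binomial_type_at_1:
  assumes "K_binomial_type emb P"
  shows "poly (P 0) 1 = 1" "poly (P (Suc n)) 1 = 0"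
proof -
  have P: "P i \<in> lin_polys q" "degree (P i) = q ^ i" for i
    using assms by (simp_all add: K_binomial_type_iff)
  have at_1: "poly (P i) 1 = (\<Sum>n\<le>i. \<iota> (K_binom i n) * poly (P n) 1 * poly (P (i - n)) 1 ^ (q ^ n))" for i
  proof -
    have "poly (P i) (\<iota> (1 * 1)) =
        (\<Sum>n\<le>i. \<iota> (K_binom i n) * poly (P n) (\<iota> 1) * poly (P (i - n)) (\<iota> 1) ^ (q ^ n))"
      using assms unfolding K_binomial_type_def card by blast
    then show ?thesis by simp
  qed
  have "degree (P 0) = 1"
    using P(2)[of 0] by simp
  then obtain a where a: "P 0 = [:0, a:]"
    using lin_polys_degree_1E[OF q_gt1 P(1)] by blast
  with P(2)[of 0] have "poly (P 0) 1 \<noteq> 0" by auto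
  moreover have "poly (P 0) 1 = poly (P 0) 1 * poly (P 0) 1"
    using at_1[of 0] by (simp add: K_binom_0)
  ultimately show P0: "poly (P 0) 1 = 1" by simp
  show "poly (P (Suc n)) 1 = 0"
  proof (induction n rule: less_induct)
    case (less n)
    have "(\<Sum>m\<le>n. \<iota> (K_binom (Suc n) m) * poly (P m) 1 * poly (P (Suc n - m)) 1 ^ (q ^ m)) =
        (\<Sum>m\<le>n. if m = 0 then poly (P (Suc n)) 1 else 0)"
    proof (rule sum.cong)
      fix m assume "m \<in> {..n}"
      then show "\<iota> (K_binom (Suc n) m) * poly (P m) 1 * poly (P (Suc n - m)) 1 ^ (q ^ m) =
          (if m = 0 then poly (P (Suc n)) 1 else 0)"
        using less by (cases m) (auto simp: K_binom_0 P0)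
    qed simp
    also have "\<dots> = poly (P (Suc n)) 1"
      by simp
    finally have low: "(\<Sum>m\<le>n. \<iota> (K_binom (Suc n) m) * poly (P m) 1 *
        poly (P (Suc n - m)) 1 ^ (q ^ m)) = poly (P (Suc n)) 1" .
    have "poly (P (Suc n)) 1 = (\<Sum>m\<le>Suc n. \<iota> (K_binom (Suc n) m) * poly (P m) 1 *
        poly (P (Suc n - m)) 1 ^ (q ^ m))"
      by (rule at_1)
    also have "\<dots> = poly (P (Suc n)) 1 + poly (P (Suc n)) 1"
      unfolding sum.atMost_Suc low by (simp add: K_binom_self P0)
    finally show ?case
      by (simp only: add_cancel_right_right)
  qed
qed

lemma binomial_imp_delta_core:
  assumes binomial: "K_binomial_type emb P" and lin: "linear_operator q T"
    and T0: "T (P 0) = 0" and T: "\<And>n. T (P (Suc n)) = smult (\<iota> (bracket (Suc n))) (P n ^ q)"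
  shows "delta_core emb T"
proof -
  have P: "P i \<in> lin_polys q" "degree (P i) = q ^ i"
    and expansion: "pcompose (P i) [:0, \<iota> s:] =
      (\<Sum>n\<le>i. smult (\<iota> (K_binom i n) * poly (P (i - n)) (\<iota> s) ^ (q ^ n)) (P n))" for i s
    using binomial by (simp_all add: K_binomial_type_iff)
  have invP: "T (pcompose (P i) [:0, \<iota> s:]) = pcompose (T (P i)) [:0, \<iota> s:]" for i s
  proof (cases i)
    case 0
    then show ?thesis
      using linear_operatorD(3)[OF lin P(1)] by (simp add: expansion T0)
  next
    case (Suc j)
    have "T (pcompose (P (Suc j)) [:0, \<iota> s:]) = smult (\<iota> (bracket (Suc j))) (pcompose (P j) [:0, \<iota> s:] ^ q)"
      unfolding expansion by (rule T_expansion[OF lin P(1) T0 T])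
    also have "\<dots> = pcompose (T (P (Suc j))) [:0, \<iota> s:]"
      by (simp add: T pcompose_smult pcompose_scale_power)
    finally show ?thesis by (simp add: Suc)
  qed
  have "T (pcompose u [:0, \<iota> s:]) = pcompose (T u) [:0, \<iota> s:]" if "u \<in> lin_polys q" for u s
  proof -
    interpret vector_space "smult :: 'c \<Rightarrow> 'c poly \<Rightarrow> 'c poly"
      by (rule vector_space_smult_poly)
    \<comment> \<open>Commutation holds on a subspace; containing every \<open>P n\<close>, it is
      all of \<open>lin_polys q\<close>.\<close>
    have "subspace {u \<in> lin_polys q. T (pcompose u [:0, \<iota> s:]) = pcompose (T u) [:0, \<iota> s:]}"
      by (rule subspaceI) (auto simp: pcompose_add pcompose_smult linear_operatorD[OF lin]
          linear_operator_0[OF lin] lin_polys_pcompose_scale)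
    moreover have "range P \<subseteq> {u \<in> lin_polys q. T (pcompose u [:0, \<iota> s:]) = pcompose (T u) [:0, \<iota> s:]}"
      using P invP by auto
    ultimately have "span (range P) \<subseteq> {u \<in> lin_polys q. T (pcompose u [:0, \<iota> s:]) = pcompose (T u) [:0, \<iota> s:]}"
      by (rule span_minimal[rotated])
    then show ?thesis
      using that span_of_degree[of q P, OF q_gt1 P] by auto
  qed
  then have inv: "invariant_operator emb T"
    using lin by (simp add: invariant_operator_def rho_def card)
  then obtain c where c: "\<And>u k. u \<in> lin_polys q \<Longrightarrow> coeff (T u) (q ^ k) = c k * coeff u (q ^ k)"
    using invariant_operator_diagonal by blast
  have top: "coeff (P n) (q ^ n) \<noteq> 0" for n
    by (rule coeff_top_nonzero[OF q_gt1 P])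
  \<comment> \<open>The coefficient of \<open>T (P (Suc n))\<close> at \<open>q ^ Suc n\<close> is
    the bracket times the \<open>q\<close>-th power of the leading coefficient of
    \<open>P n\<close>, hence nonzero.\<close>
  have "c (Suc n) \<noteq> 0" for n
  proof
    assume "c (Suc n) = 0"
    then have "coeff (T (P (Suc n))) (q ^ Suc n) = 0"
      using c[OF P(1), of "Suc n" "Suc n"] by simp
    then have "\<iota> (bracket (Suc n)) * coeff (P n) (q ^ n) ^ q = 0"
      unfolding T coeff_smult coeff_power_q(2)[OF P(1)] .
    then show False using top[of n] bracket_nonzero[of n] by simp
  qed
  then have nonzero: "T f \<noteq> 0" if f: "f \<in> lin_polys q" "degree f > 1" for f
  proof -
    have "coeff f (degree f) \<noteq> 0" using f(2) by auto
    moreover from this obtain k where k: "degree f = q ^ k" using lin_polysD[OF f(1)] by blast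
    moreover obtain j where "k = Suc j" using k f(2) by (cases k) auto
    ultimately have "coeff (T f) (q ^ k) \<noteq> 0"
      using c[OF f(1), of k] \<open>\<And>n. c (Suc n) \<noteq> 0\<close> by simp
    then show ?thesis by auto
  qed
  have "T [:0, 1:] = 0"
  proof (rule lin_polys_eqI)
    \<comment> \<open>\<open>P 0\<close> has a nonzero linear coefficient but is sent to 0.\<close>
    have "c 0 = 0" using c[OF P(1), of 0 0] T0 top[of 0] by simp
    fix k show "coeff (T [:0, 1:]) (q ^ k) = coeff 0 (q ^ k)"
    proof (cases k)
      case (Suc j)
      have "coeff [:0, 1 :: 'c:] (q ^ k) = 0"
        using coeff_linear_power[OF q_gt1] Suc by blast
      then show ?thesis using c[of "[:0, 1:]" k] by simp
    qed (use c[of "[:0, 1:]" k] \<open>c 0 = 0\<close> in simp)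
  qed (use lin in \<open>auto intro: linear_operatorD(1)\<close>)
  with inv nonzero show ?thesis
    by (simp add: delta_core_def card)
qed

text \<open>Ensures that \<open>tau_inv\<close> loses no information on values of a core operator;
  the reason is the zero eigenvalue at index 0.\<close>

lemma delta_core_coeff_1:
  assumes "delta_core emb T" "u \<in> lin_polys q"
  shows "coeff (T u) 1 = 0"
proof (rule delta_core_diagonal[OF assms(1)])
  fix c assume c: "\<And>u k. u \<in> lin_polys q \<Longrightarrow> coeff (T u) (q ^ k) = c k * coeff u (q ^ k)" and "c 0 = 0"
  with c[OF assms(2), of 0] show ?thesis by simp
qed

end

section \<open>Both directions for delta operators\<close>

theorem theorem1:
  fixes emb :: "'a::{field,finite} fls alg_closure \<Rightarrow> 'c::{field,complete_space}"
    and absv :: "'c \<Rightarrow> real"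
    and p \<nu> :: nat
  assumes "prime p" and "CARD('a) = p ^ \<nu>"
    and "completed_alg_closure emb absv"
  shows
    "(\<forall>\<delta>. delta_operator emb \<delta> \<longrightarrow>
        (\<exists>!P. basic_sequence emb \<delta> P) \<and>
        (\<forall>P. basic_sequence emb \<delta> P \<longrightarrow> K_binomial_type emb P)) \<and>
     (\<forall>P. K_binomial_type emb P \<longrightarrow>
        inj P \<and> \<not> module.dependent smult (range P) \<and>
        module.span smult (range P) = lin_polys CARD('a) \<and>
        (\<exists>\<delta>0. linear_operator CARD('a) \<delta>0 \<and> \<delta>0 (P 0) = 0 \<and>
          (\<forall>n\<ge>1. \<delta>0 (P n) = smult (of_K emb (bracket n)) (P (n - 1) ^ CARD('a)))) \<and>
        (\<forall>\<delta>0. linear_operator CARD('a) \<delta>0 \<and> \<delta>0 (P 0) = 0 \<and>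
          (\<forall>n\<ge>1. \<delta>0 (P n) = smult (of_K emb (bracket n)) (P (n - 1) ^ CARD('a))) \<longrightarrow>
          delta_core emb \<delta>0 \<and>
          delta_operator emb (\<lambda>u. tau_inv CARD('a) (\<delta>0 u)) \<and>
          basic_sequence emb (\<lambda>u. tau_inv CARD('a) (\<delta>0 u)) P))"
proof -
  interpret carlitz emb absv p \<nu> "CARD('a)"
    by (intro carlitz.intro carlitz_axioms.intro assms refl)
  have a: "(\<exists>!P. basic_sequence emb \<delta> P) \<and> (\<forall>P. basic_sequence emb \<delta> P \<longrightarrow> K_binomial_type emb P)"
    if \<delta>: "delta_operator emb \<delta>" for \<delta>
  proof -
    obtain T where T: "delta_core emb T" "\<forall>u\<in>lin_polys CARD('a). \<delta> u = tau_inv CARD('a) (T u)"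
      using \<delta> unfolding delta_operator_def by blast
    have "basic_sequence emb \<delta> P \<longleftrightarrow> basic_core T P" for P
      using T delta_core_coeff_1[OF T(1)]
      by (intro basic_sequence_iff) (simp_all add: delta_core_def invariant_operator_def)
    then show ?thesis
      using ex1_basic_core[OF T(1)] basic_core_imp_binomial[OF T(1)] by simp
  qed
  have b: "inj P \<and> \<not> module.dependent smult (range P) \<and>
        module.span smult (range P) = lin_polys CARD('a) \<and>
        (\<exists>\<delta>0. linear_operator CARD('a) \<delta>0 \<and> \<delta>0 (P 0) = 0 \<and>
          (\<forall>n\<ge>1. \<delta>0 (P n) = smult (of_K emb (bracket n)) (P (n - 1) ^ CARD('a))))"
    if "K_binomial_type emb P" for P
  proof -
    have P: "P i \<in> lin_polys CARD('a)" "degree (P i) = CARD('a) ^ i" for i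
      using that by (simp_all add: K_binomial_type_def)
    define f where "f n = (if n = 0 then 0 else smult (\<iota> (bracket n)) (P (n - 1) ^ CARD('a)))" for n
    have "f n \<in> lin_polys CARD('a)" for n
      using P(1) coeff_power_q(1) by (auto simp: f_def)
    then obtain T where "linear_operator CARD('a) T" "\<And>n. T (P n) = f n"
      using linear_operator_extend[OF q_gt1 P, of f] by blast
    then show ?thesis
      using inj_of_degree[OF q_gt1 P] independent_of_degree[OF q_gt1 P] span_of_degree[OF q_gt1 P]
      by (auto simp: f_def intro!: exI[of _ T])
  qed
  \<comment> \<open>Shown for every operator with the prescribed values on the basis, whatever it
    does outside \<open>lin_polys CARD('a)\<close>.\<close>
  have c: "delta_core emb T \<and> delta_operator emb (\<lambda>u. tau_inv CARD('a) (T u)) \<and>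
      basic_sequence emb (\<lambda>u. tau_inv CARD('a) (T u)) P"
    if P: "K_binomial_type emb P" and lin: "linear_operator CARD('a) T" and T: "T (P 0) = 0"
      "\<forall>n\<ge>1. T (P n) = smult (of_K emb (bracket n)) (P (n - 1) ^ CARD('a))" for P T
  proof -
    have TS: "T (P (Suc n)) = smult (\<iota> (bracket (Suc n))) (P n ^ CARD('a))" for n
      using T(2)[rule_format, of "Suc n"] by simp
    have core: "delta_core emb T"
      by (rule binomial_imp_delta_core[OF P lin T(1) TS])
    have "basic_core T P"
      using P T(1) TS binomial_type_at_1[OF P] by (simp add: basic_core_def K_binomial_type_def)
    moreover have "basic_sequence emb (\<lambda>u. tau_inv CARD('a) (T u)) P \<longleftrightarrow> basic_core T P"
      by (intro basic_sequence_iff lin delta_core_coeff_1[OF core] refl)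
    moreover have "delta_operator emb (\<lambda>u. tau_inv CARD('a) (T u))"
      using core unfolding delta_operator_def by blast
    ultimately show ?thesis using core by blast
  qed
  show ?thesis
    using a b c by blast
qed

end
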